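(* Let $k\ge 2$ be an integer. Then the four spanning trees $T_k^{(1)},T_k^{(2)},T_k^{(3)},T_k^{(4)}$ of the dense Gaussian network $G_k$ (defined in the context), all rooted at the node $0$, are pairwise node-independent.
   Context: For an integer $k\ge 2$ let $\alpha_k=k+(k+1)i\in\mathbb{Z}[i]$. The dense Gaussian network $G_k=(V_k,E_k)$ is the undirected graph with node set $V_k=\{x+yi : x,y\in\mathbb{Z},\ |x|+|y|\le k\}$ (a complete system of representatives of $\mathbb{Z}[i]$ modulo $\alpha_k$), in which two nodes $A,B$ are adjacent if and only if $A-B$ is congruent modulo $\alpha_k$ to one of $1,-1,i,-i$. For $z\in\mathbb{Z}[i]$, $z \bmod \alpha_k$ denotes the unique element of $V_k$ congruent to $z$ modulo $\alpha_k$. All edges are regarded as undirected. Let $E_k^V=\{(v,(v+i)\bmod\alpha_k) : v\in V_k\}$ be the set of vertical edges. Define $$\begin{aligned}E_k^{(1)}=\Big(E_k^V&\setminus\big(\{(qi,(q+1)i): 0\le q\le k-1\}\cup\{(q-i,q): -k+1\le q\le 0\}\cup\{(-k,ki)\}\big)\Big)\\&\cup\{(q,q+1): 0\le q\le k-1\}\cup\{(-1+qi,qi): 1\le q\le k-1\}\cup\{(k,ki)\},\end{aligned}$$ where $q$ ranges over integers, and $T_k^{(1)}=(V_k,E_k^{(1)})$. Let $\rho:V_k\to V_k$, $\rho(x+yi)=-y+xi$ (counterclockwise rotation by $90^\circ$), extended to edges by $\rho(u,v)=(\rho(u),\rho(v))$ and to subgraphs by applying it to the node and edge sets. For $j=2,3,4$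 let $T_k^{(j)}=\rho^{\,j-1}(T_k^{(1)})$. Each $T_k^{(j)}$ is a spanning tree of $G_k$, considered as rooted at $0$. Two spanning trees of a graph, both rooted at a node $r$, are node-independent if for every node $u\ne r$ the path from $r$ to $u$ in the first tree and the path from $r$ to $u$ in the second tree have no common nodes other than the end nodes $r$ and $u$. *)

theory Defs
  imports Complex_Main
begin

text \<open>An undirected edge between \<open>a\<close> and \<open>b\<close> is the unordered pair \<open>{a, b}\<close>.\<close>

record 'a ugraph =
  nodes :: "'a set"
  edges :: "'a set set"

definition simple_ugraph :: "'a ugraph \<Rightarrow> bool" where
  "simple_ugraph G \<longleftrightarrow>
     (\<forall>e \<in> edges G. \<exists>a b. a \<in> nodes G \<and> b \<in> nodes G \<and> a \<noteq> b \<and> e = {a, b})"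

definition is_path :: "'a ugraph \<Rightarrow> 'a \<Rightarrow> 'a list \<Rightarrow> 'a \<Rightarrow> bool" where
  "is_path G u p v \<longleftrightarrow>
     p \<noteq> [] \<and> hd p = u \<and> last p = v \<and> distinct p \<and> set p \<subseteq> nodes G \<and>
     successively (\<lambda>a b. {a, b} \<in> edges G) p"

definition is_cycle :: "'a ugraph \<Rightarrow> 'a list \<Rightarrow> bool" where
  "is_cycle G p \<longleftrightarrow>
     length p \<ge> 3 \<and> distinct p \<and> set p \<subseteq> nodes G \<and>
     successively (\<lambda>a b. {a, b} \<in> edges G) p \<and> {last p, hd p} \<in> edges G"

definition is_tree :: "'a ugraph \<Rightarrow> bool" where
  "is_tree T \<longleftrightarrow>
     simple_ugraph T \<and> nodes T \<noteq> {} \<and>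
     (\<forall>u \<in> nodes T. \<forall>v \<in> nodes T. \<exists>p. is_path T u p v) \<and>
     (\<nexists>p. is_cycle T p)"

definition is_spanning_tree :: "'a ugraph \<Rightarrow> 'a ugraph \<Rightarrow> bool" where
  "is_spanning_tree T G \<longleftrightarrow> is_tree T \<and> nodes T = nodes G \<and> edges T \<subseteq> edges G"

text \<open>In a tree there is exactly one path between two given nodes, so quantifying over all
  paths \<open>p\<close> and \<open>q\<close> below refers to the unique path in each of the two trees.\<close>

definition node_independent :: "'a ugraph \<Rightarrow> 'a \<Rightarrow> 'a ugraph \<Rightarrow> 'a ugraph \<Rightarrow> bool" where
  "node_independent G r S T \<longleftrightarrow>
     r \<in> nodes G \<and> is_spanning_tree S G \<and> is_spanning_tree T G \<and>
     (\<forall>u \<in> nodes G. u \<noteq> r \<longrightarrow>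
        (\<forall>p q. is_path S r p u \<and> is_path T r q u \<longrightarrow> set p \<inter> set q = {r, u}))"

definition gauss_ints :: "complex set" where
  "gauss_ints = {of_int x + of_int y * \<i> | x y. True}"

definition alpha :: "nat \<Rightarrow> complex" where
  "alpha k = of_nat k + (of_nat k + 1) * \<i>"

definition gauss_cong :: "nat \<Rightarrow> complex \<Rightarrow> complex \<Rightarrow> bool" where
  "gauss_cong k a b \<longleftrightarrow> (\<exists>c \<in> gauss_ints. a - b = c * alpha k)"

definition V :: "nat \<Rightarrow> complex set" where
  "V k = {of_int x + of_int y * \<i> | x y :: int. \<bar>x\<bar> + \<bar>y\<bar> \<le> int k}"

definition gauss_mod :: "nat \<Rightarrow> complex \<Rightarrow> complex" where
  "gauss_mod k z = (THE w. w \<in> V k \<and> gauss_cong k w z)"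

definition dense_gaussian_network :: "nat \<Rightarrow> complex ugraph" where
  "dense_gaussian_network k =
     \<lparr>nodes = V k,
      edges = {{a, b} | a b. a \<in> V k \<and> b \<in> V k \<and>
                 (\<exists>d \<in> {1, -1, \<i>, -\<i>}. gauss_cong k (a - b) d)}\<rparr>"

definition vertical_edges :: "nat \<Rightarrow> complex set set" where
  "vertical_edges k = {{v, gauss_mod k (v + \<i>)} | v. v \<in> V k}"

text \<open>The edge \<open>{-k, k\<i>}\<close> removed here is the vertical edge of \<open>v = k\<i>\<close>, since
  \<open>k\<i> + \<i>\<close> is congruent to \<open>-k\<close>.\<close>

definition tree1_edges :: "nat \<Rightarrow> complex set set" where
  "tree1_edges k =
     (vertical_edges k -
        ({{of_int q * \<i>, (of_int q + 1) * \<i>} | q :: int. 0 \<le> q \<and> q \<le> int k - 1} \<union>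
         {{of_int q - \<i>, of_int q} | q :: int. - int k + 1 \<le> q \<and> q \<le> 0} \<union>
         {{- of_nat k, of_nat k * \<i>}})) \<union>
     {{of_int q, of_int q + 1} | q :: int. 0 \<le> q \<and> q \<le> int k - 1} \<union>
     {{-1 + of_int q * \<i>, of_int q * \<i>} | q :: int. 1 \<le> q \<and> q \<le> int k - 1} \<union>
     {{of_nat k, of_nat k * \<i>}}"

definition tree1 :: "nat \<Rightarrow> complex ugraph" where
  "tree1 k = \<lparr>nodes = V k, edges = tree1_edges k\<rparr>"

definition rot :: "complex \<Rightarrow> complex" where
  "rot z = Complex (- Im z) (Re z)"

definition rot_graph :: "complex ugraph \<Rightarrow> complex ugraph" where
  "rot_graph T = \<lparr>nodes = rot ` nodes T, edges = (\<lambda>e. rot ` e) ` edges T\<rparr>"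

text \<open>Meaningful for \<open>1 \<le> j \<le> 4\<close>.\<close>

definition gauss_tree :: "nat \<Rightarrow> nat \<Rightarrow> complex ugraph" where
  "gauss_tree k j = (rot_graph ^^ (j - 1)) (tree1 k)"

end

theory Submission
  imports Defs
begin

text \<open>The vertical edges form a Hamiltonian cycle: from the top of column \<open>x \<ge> 0\<close> one moves to the
  bottom of column \<open>x - k\<close>, and from the top of column \<open>x < 0\<close> to the bottom of column \<open>x + k + 1\<close>.
  So in \<open>T\<^sub>1\<close> every path from \<open>0\<close> first follows the positive real axis to some column \<open>x \<ge> 1\<close>,
  leaves along this column, and possibly crosses from its top to the lower half of column \<open>x - k\<close>
  or from its bottom to the upper half of column \<open>x - k - 1\<close>; the nodes of the positive imaginary axis
  are appended as leaves. This gives an explicit description of the nodes on the path to each \<open>u\<close>.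
  Rotating the description, pairwise independence becomes a statement of linear integer arithmetic;
  by symmetry only \<open>T\<^sub>1\<close> against each of the other trees has to be considered.\<close>

section \<open>Rooted trees given by a parent function\<close>

text \<open>The function \<open>d\<close> strictly decreases along \<open>par\<close>, so iterating
  \<open>par\<close> ends at \<open>r\<close>; this yields connectedness and excludes
  cycles.\<close>

definition rooted_by :: "'a ugraph \<Rightarrow> 'a \<Rightarrow> ('a \<Rightarrow> 'a) \<Rightarrow> ('a \<Rightarrow> nat) \<Rightarrow> bool" where
  "rooted_by T r par d \<longleftrightarrow>
     r \<in> nodes T \<and> edges T = {{v, par v} | v. v \<in> nodes T - {r}} \<and>
     (\<forall>v \<in> nodes T - {r}. par v \<in> nodes T \<and> d (par v) < d v)"

lemma rooted_by_edgeD: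
  assumes "rooted_by T r par d" "{a, b} \<in> edges T"
  shows "(a \<noteq> r \<and> b = par a \<and> d b < d a) \<or> (b \<noteq> r \<and> a = par b \<and> d a < d b)"
  using assms unfolding rooted_by_def by (auto simp: doubleton_eq_iff)

lemma rooted_by_edgeI:
  assumes "rooted_by T r par d" "v \<in> nodes T" "v \<noteq> r"
  shows "{v, par v} \<in> edges T"
  using assms unfolding rooted_by_def by auto

lemma is_path_rev:
  assumes "is_path G u p v"
  shows "is_path G v (rev p) u"
  using assms unfolding is_path_def
  by (auto simp: hd_rev last_rev insert_commute)

text \<open>The bound on \<open>d\<close> serves the induction: since
  \<open>d (par v) < d v\<close>, it keeps \<open>v\<close> off the path already found from
  \<open>par v\<close>.\<close>

lemma rooted_by_path_to_root:
  assumes T: "rooted_by T r par d" and "v \<in> nodes T"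
  shows "\<exists>p. is_path T v p r \<and> (\<forall>w \<in> set p. d w \<le> d v)"
  using assms(2)
proof (induction "d v" arbitrary: v rule: less_induct)
  case less
  show ?case
  proof (cases "v = r")
    case True
    then have "is_path T v [v] r"
      using less.prems by (auto simp: is_path_def)
    then show ?thesis by force
  next
    case False
    then have par: "par v \<in> nodes T" "d (par v) < d v"
      using T less.prems unfolding rooted_by_def by auto
    then obtain p where p: "is_path T (par v) p r" "\<forall>w \<in> set p. d w \<le> d (par v)"
      using less.hyps by blast
    have "is_path T v (v # p) r"
      using p par less.prems rooted_by_edgeI[OF T less.prems False]
      by (cases p) (auto simp: is_path_def)
    moreover have "\<forall>w \<in> set (v # p). d w \<le> d v"
      using p par by force
    ultimately show ?thesis by blast
  qed
qed

text \<open>A path leaving the root can only climb: descending once would revisit the previous node.\<close>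

lemma rooted_by_path_climbs:
  assumes T: "rooted_by T r par d"
    and "p \<noteq> []" "hd p = r" "distinct p" "successively (\<lambda>a b. {a, b} \<in> edges T) p"
  shows "successively (\<lambda>a b. b \<noteq> r \<and> a = par b) p"
  using assms(2-)
proof (induction p rule: rev_induct)
  case Nil
  then show ?case by simp
next
  case (snoc w p)
  show ?case
  proof (cases p rule: rev_cases)
    case Nil
    then show ?thesis by simp
  next
    case (snoc p' v)
    have IH: "successively (\<lambda>a b. b \<noteq> r \<and> a = par b) p"
      using snoc.IH snoc.prems snoc by (auto simp: successively_append_iff hd_append)
    have edge: "{v, w} \<in> edges T"
      using snoc.prems snoc by (auto simp: successively_append_iff)
    have "\<not> (v \<noteq> r \<and> w = par v)"
    proof
      assume *: "v \<noteq> r \<and> w = par v"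
      have "p' \<noteq> []"
        using * snoc snoc.prems by (cases p') auto
      then have "last p' = par v"
        using IH snoc by (auto simp: successively_append_iff)
      with * \<open>p' \<noteq> []\<close> have "w \<in> set p'" using last_in_set[of p'] by simp
      then show False using snoc snoc.prems by auto
    qed
    then have "w \<noteq> r \<and> v = par w"
      using rooted_by_edgeD[OF T edge] by blast
    then show ?thesis
      using IH snoc by (auto simp: successively_append_iff)
  qed
qed

text \<open>Paths from the root only climb, so any family \<open>S\<close> that grows from parent to
  child encloses them. Independence needs upper bounds on paths only, hence \<open>S\<close> may be
  an over-approximation.\<close>

lemma rooted_by_path_subset:
  assumes T: "rooted_by T r par d" and p: "is_path T r p u"
    and r: "r \<in> S r"
    and step: "\<And>v. v \<in> nodes T \<Longrightarrow> v \<noteq> r \<Longrightarrow> insert v (S (par v)) \<subseteq> S v"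
  shows "set p \<subseteq> S u"
proof -
  have "successively (\<lambda>a b. b \<noteq> r \<and> a = par b) p"
    using rooted_by_path_climbs[OF T] p by (auto simp: is_path_def)
  moreover have "p \<noteq> []" "hd p = r" "last p = u" "set p \<subseteq> nodes T"
    using p by (auto simp: is_path_def)
  ultimately show ?thesis
  proof (induction p arbitrary: u rule: rev_induct)
    case Nil
    then show ?case by simp
  next
    case (snoc w p)
    show ?case
    proof (cases "p = []")
      case True
      then show ?thesis using snoc.prems r by auto
    next
      case False
      then have w: "w = u" "w \<noteq> r" "last p = par w" "w \<in> nodes T"
        using snoc.prems by (auto simp: successively_append_iff)
      have "set p \<subseteq> S (par w)"
        using snoc.IH[of "par w"] snoc.prems False w by (auto simp: successively_append_iff)
      then show ?thesis using step[OF w(4,2)] w by auto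
    qed
  qed
qed

text \<open>At a node of largest \<open>d\<close> on a cycle both cycle edges lead to its parent, so
  its two neighbours coincide; with at least three distinct nodes this is impossible.\<close>

lemma rooted_by_acyclic:
  assumes T: "rooted_by T r par d"
  shows "\<not> is_cycle T p"
proof
  assume p: "is_cycle T p"
  define n where "n = length p"
  have n: "n \<ge> 3" and dist: "distinct p"
    using p by (auto simp: is_cycle_def n_def)
  have edge: "{p ! i, p ! (Suc i mod n)} \<in> edges T" if "i < n" for i
  proof (cases "Suc i = n")
    case True
    then have "{last p, hd p} = {p ! i, p ! (Suc i mod n)}"
      using n last_conv_nth[of p] hd_conv_nth[of p] by (force simp: n_def)
    then show ?thesis using p by (simp add: is_cycle_def)
  next
    case False
    then show ?thesis
      using p that by (auto simp: is_cycle_def n_def successively_conv_nth)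
  qed
  obtain i where i: "i < n" and max: "\<And>j. j < n \<Longrightarrow> d (p ! j) \<le> d (p ! i)"
  proof -
    have "Max ((\<lambda>j. d (p ! j)) ` {..<n}) \<in> (\<lambda>j. d (p ! j)) ` {..<n}"
      using n by (intro Max_in) (auto simp: lessThan_empty_iff)
    then obtain i where "i < n" "d (p ! i) = Max ((\<lambda>j. d (p ! j)) ` {..<n})" by auto
    then show thesis using that by simp
  qed
  \<comment> \<open>\<open>j\<close> and \<open>l\<close> are the cyclic predecessor and successor
    of \<open>i\<close>; they differ because a cycle has length at least 3.\<close>
  define j where "j = (if i = 0 then n - 1 else i - 1)"
  have j: "j < n" "Suc j mod n = i" using i n by (auto simp: j_def)
  define l where "l = Suc i mod n"
  have l: "l < n" using n by (simp add: l_def)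
  have "j \<noteq> l"
    using i n by (cases "Suc i = n") (auto simp: j_def l_def)
  moreover have "p ! l = par (p ! i)"
    using rooted_by_edgeD[OF T edge[OF i]] max[OF l] by (auto simp: l_def)
  moreover have "p ! j = par (p ! i)"
    using rooted_by_edgeD[OF T edge[OF j(1)]] max[OF j(1)] j by auto
  ultimately show False
    using dist j l nth_eq_iff_index_eq[of p j l] by (simp add: n_def)
qed

text \<open>Paths have distinct nodes, so plain appending may fail. The nodes of \<open>p\<close>
  are prepended one at a time; if a node already lies on the path built so far, everything before it
  is cut off.\<close>

lemma is_path_concat_exists:
  assumes "is_path G u p v" "is_path G v q w"
  shows "\<exists>s. is_path G u s w"
  using assms
proof (induction p arbitrary: u)
  case Nil
  then show ?case by (simp add: is_path_def)
next
  case (Cons a p)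
  have a: "a = u" using Cons.prems by (simp add: is_path_def)
  show ?case
  proof (cases "p = []")
    case True
    then show ?thesis using Cons.prems by (auto simp: is_path_def)
  next
    case False
    then have "is_path G (hd p) p v"
      using Cons.prems(1) by (cases p) (auto simp: is_path_def)
    then obtain s where s: "is_path G (hd p) s w" using Cons.IH Cons.prems(2) by blast
    show ?thesis
    proof (cases "u \<in> set s")
      case True
      then obtain s1 s2 where "s = s1 @ u # s2" by (auto simp: in_set_conv_decomp)
      then have "is_path G u (u # s2) w"
        using s by (auto simp: is_path_def successively_append_iff)
      then show ?thesis by blast
    next
      case u: False
      have "{u, hd p} \<in> edges G" "u \<in> nodes G"
        using Cons.prems(1) a False by (cases p; auto simp: is_path_def)+
      then have "is_path G u (u # s) w"
        using s u by (cases s) (auto simp: is_path_def)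
      then show ?thesis by blast
    qed
  qed
qed

lemma rooted_by_is_tree:
  assumes T: "rooted_by T r par d"
  shows "is_tree T"
  unfolding is_tree_def
proof (intro conjI ballI)
  show "simple_ugraph T"
    unfolding simple_ugraph_def
  proof
    fix e assume "e \<in> edges T"
    then obtain v where v: "v \<in> nodes T" "v \<noteq> r" "e = {v, par v}"
      using T unfolding rooted_by_def by blast
    then have "par v \<in> nodes T" "d (par v) < d v"
      using T unfolding rooted_by_def by auto
    with v show "\<exists>a b. a \<in> nodes T \<and> b \<in> nodes T \<and> a \<noteq> b \<and> e = {a, b}"
      by (intro exI[of _ v] exI[of _ "par v"]) auto
  qed
  show "nodes T \<noteq> {}" using T by (auto simp: rooted_by_def)
  show "\<nexists>p. is_cycle T p" using rooted_by_acyclic[OF T] by blast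
  fix u v assume "u \<in> nodes T" "v \<in> nodes T"
  then obtain p q where p: "is_path T u p r" and q: "is_path T v q r"
    using rooted_by_path_to_root[OF T \<open>u \<in> nodes T\<close>]
      rooted_by_path_to_root[OF T \<open>v \<in> nodes T\<close>] by (elim exE conjE)
  show "\<exists>p. is_path T u p v"
    by (rule is_path_concat_exists[OF p is_path_rev[OF q]])
qed

lemma rooted_by_rot:
  assumes "rooted_by T r par d" "\<And>z. rot' (rot z) = z" "rot r = r"
  shows "rooted_by (rot_graph T) r (rot \<circ> par \<circ> rot') (d \<circ> rot')"
proof -
  have inj: "rot a = rot b \<longleftrightarrow> a = b" for a b using assms(2) by metis
  have *: "rot ` nodes T - {r} = rot ` (nodes T - {r})"
    using assms(3) inj by (auto simp: image_iff)
  have edges: "edges T = (\<lambda>v. {v, par v}) ` (nodes T - {r})"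
    using assms(1) by (auto simp: rooted_by_def)
  have "r \<in> rot ` nodes T"
    using assms(1,3) by (auto simp: rooted_by_def intro: rev_image_eqI[of r])
  moreover have "edges (rot_graph T) = {{v, (rot \<circ> par \<circ> rot') v} | v. v \<in> nodes (rot_graph T) - {r}}"
    unfolding Setcompr_eq_image
    by (simp add: rot_graph_def * edges image_image assms(2))
  moreover have "\<forall>v \<in> nodes T - {r}. par v \<in> nodes T \<and> d (par v) < d v"
    using assms(1) by (auto simp: rooted_by_def)
  ultimately show ?thesis
    using assms(2) unfolding rooted_by_def by (simp add: rot_graph_def *)
qed

section \<open>The first tree in coordinates\<close>

text \<open>Injective integer coordinates turn statements about Gaussian integers into arithmetic
  over \<open>int\<close>.\<close>

definition pt :: "int \<Rightarrow> int \<Rightarrow> complex" where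
  "pt x y = Complex (of_int x) (of_int y)"

lemma pt_eq_iff [simp]: "pt a b = pt c d \<longleftrightarrow> a = c \<and> b = d"
  by (simp add: pt_def)

lemma pt_0_0: "0 = pt 0 0"
  by (simp add: pt_def complex_eq_iff)

lemma of_int_pt: "of_int x + of_int y * \<i> = pt x y"
  by (simp add: pt_def complex_eq_iff)

lemma V_eq: "V k = {pt x y | x y. \<bar>x\<bar> + \<bar>y\<bar> \<le> int k}"
  by (simp add: V_def of_int_pt)

lemma pt_in_V_iff [simp]: "pt x y \<in> V k \<longleftrightarrow> \<bar>x\<bar> + \<bar>y\<bar> \<le> int k"
  by (auto simp: V_eq)

section \<open>Congruence modulo \<alpha> and vertical steps in coordinates\<close>

lemma gauss_cong_pt:
  "gauss_cong k (pt a b) (pt c d) \<longleftrightarrow>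
     (\<exists>m n. a - c = m * int k - n * (int k + 1) \<and> b - d = m * (int k + 1) + n * int k)"
proof -
  have *: "pt a b - pt c d = pt (a - c) (b - d)"
    "pt m n * alpha k = pt (m * int k - n * (int k + 1)) (m * (int k + 1) + n * int k)" for m n
    by (auto simp: pt_def complex_eq_iff alpha_def algebra_simps)
  have "gauss_cong k (pt a b) (pt c d) \<longleftrightarrow> (\<exists>m n. pt (a - c) (b - d) = pt m n * alpha k)"
    unfolding gauss_cong_def gauss_ints_def of_int_pt *(1) by blast
  then show ?thesis by (simp add: *(2))
qed

text \<open>Two nodes of \<open>V k\<close> are at most 2k apart in the 1-norm, whereas a nonzero
  multiple of \<alpha> has 1-norm at least 2k + 1.\<close>

lemma V_cong_unique:
  assumes "\<bar>a\<bar> + \<bar>b\<bar> \<le> int k" "\<bar>c\<bar> + \<bar>d\<bar> \<le> int k" "gauss_cong k (pt a b) (pt c d)"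
  shows "a = c \<and> b = d"
proof -
  obtain m n where mn: "a - c = m * int k - n * (int k + 1)" "b - d = m * (int k + 1) + n * int k"
    using assms(3) by (auto simp: gauss_cong_pt)
  \<comment> \<open>Sum and difference of the coordinates of the displacement are
    \<open>m * N - n\<close> and \<open>n * N + m\<close>. They are the parts of (m + ni)(N + i),
    because (1 - i) \<alpha> = N + i; this explains the norm identity below.\<close>
  define N where "N = 2 * int k + 1"
  have s: "\<bar>m * N - n\<bar> < N" and t: "\<bar>n * N + m\<bar> < N"
    using assms(1,2) mn by (auto simp: N_def algebra_simps abs_if split: if_splits)
  have "(m\<^sup>2 + n\<^sup>2) * (N\<^sup>2 + 1) = \<bar>m * N - n\<bar>\<^sup>2 + \<bar>n * N + m\<bar>\<^sup>2"
    by (simp add: power2_eq_square algebra_simps)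
  also have "\<dots> < 2 * (N\<^sup>2 + 1)"
    using s t power_mono[of "\<bar>m * N - n\<bar>" N 2] power_mono[of "\<bar>n * N + m\<bar>" N 2] by simp
  finally have less: "m\<^sup>2 + n\<^sup>2 < 2"
    by (rule mult_right_less_imp_less) simp
  have "m = 0 \<and> n = 0"
  proof (rule ccontr)
    assume "\<not> (m = 0 \<and> n = 0)"
    moreover have "\<bar>z\<bar> \<le> z\<^sup>2" for z :: int
      using self_le_power[of "\<bar>z\<bar>" 2] by (cases "z = 0") simp_all
    note this[of m] this[of n]
    \<comment> \<open>Only the four units remain, and each of them makes one of the two bounded
      expressions equal to N in absolute value.\<close>
    ultimately have "(m, n) \<in> {(1, 0), (-1, 0), (0, 1), (0, -1)}" using less by auto
    then show False using s t by auto
  qed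
  then show ?thesis using mn by simp
qed

lemma gauss_mod_pt:
  assumes "\<bar>a\<bar> + \<bar>b\<bar> \<le> int k" "gauss_cong k (pt a b) (pt c d)"
  shows "gauss_mod k (pt c d) = pt a b"
  unfolding gauss_mod_def
proof (rule the_equality)
  fix w assume w: "w \<in> V k \<and> gauss_cong k w (pt c d)"
  then obtain x y where xy: "w = pt x y" "\<bar>x\<bar> + \<bar>y\<bar> \<le> int k" by (auto simp: V_eq)
  obtain m n where mn: "x - c = m * int k - n * (int k + 1)" "y - d = m * (int k + 1) + n * int k"
    using w xy by (auto simp: gauss_cong_pt)
  obtain m' n' where mn': "a - c = m' * int k - n' * (int k + 1)" "b - d = m' * (int k + 1) + n' * int k"
    using assms(2) by (auto simp: gauss_cong_pt)
  have "x - a = (m - m') * int k - (n - n') * (int k + 1)"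
    "y - b = (m - m') * (int k + 1) + (n - n') * int k"
    using mn mn' by (simp_all add: algebra_simps)
  then have "gauss_cong k (pt x y) (pt a b)" unfolding gauss_cong_pt by blast
  then show "w = pt a b" using V_cong_unique[OF xy(2) assms(1)] xy by simp
qed (use assms in auto)

text \<open>Closed form of v + i reduced modulo \<alpha>: a step beyond the top of a column is
  corrected by subtracting \<alpha> if x \<ge> 0 and i \<alpha> if x < 0.\<close>

definition up :: "nat \<Rightarrow> int \<Rightarrow> int \<Rightarrow> complex" where
  "up k x y =
     (if \<bar>x\<bar> + \<bar>y + 1\<bar> \<le> int k then pt x (y + 1)
      else if x \<ge> 0 then pt (x - int k) (- x)
      else pt (x + int k + 1) (x + 1))"

lemma up_props:
  assumes "\<bar>x\<bar> + \<bar>y\<bar> \<le> int k"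
  shows "up k x y \<in> V k \<and> gauss_cong k (up k x y) (pt x (y + 1))"
proof -
  consider "\<bar>x\<bar> + \<bar>y + 1\<bar> \<le> int k" | "\<not> \<bar>x\<bar> + \<bar>y + 1\<bar> \<le> int k" "x \<ge> 0" "y = int k - x" "x \<le> int k"
    | "\<not> \<bar>x\<bar> + \<bar>y + 1\<bar> \<le> int k" "x < 0" "y = int k + x" "- x \<le> int k"
    using assms by linarith
  then show ?thesis
  proof cases
    case 1
    then show ?thesis by (auto simp: up_def gauss_cong_pt intro!: exI[of _ 0])
  next
    case 2
    then have "up k x y = pt (x - int k) (- x)" by (simp add: up_def)
    then show ?thesis using 2
      by (auto simp: gauss_cong_pt intro!: exI[of _ "-1 :: int", OF exI[of _ "0 :: int"]])
  next
    case 3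
    then have "up k x y = pt (x + int k + 1) (x + 1)" by (simp add: up_def)
    then show ?thesis using 3
      by (auto simp: gauss_cong_pt intro!: exI[of _ "0 :: int", OF exI[of _ "-1 :: int"]])
  qed
qed

lemma gauss_mod_up:
  assumes "\<bar>x\<bar> + \<bar>y\<bar> \<le> int k"
  shows "gauss_mod k (pt x y + \<i>) = up k x y"
proof -
  have "pt x y + \<i> = pt x (y + 1)" by (simp add: pt_def complex_eq_iff)
  moreover obtain a b where "up k x y = pt a b" using up_props[OF assms] by (auto simp: V_eq)
  ultimately show ?thesis using up_props[OF assms] gauss_mod_pt[of a b k x "y + 1"] by simp
qed

lemma vertical_edges_eq:
  "vertical_edges k = {{pt x y, up k x y} | x y. \<bar>x\<bar> + \<bar>y\<bar> \<le> int k}"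
  unfolding vertical_edges_def V_eq using gauss_mod_up by force


lemma tree1_edges_pt:
  "tree1_edges k =
     (vertical_edges k -
        ({{pt 0 q, pt 0 (q + 1)} | q. 0 \<le> q \<and> q \<le> int k - 1} \<union>
         {{pt q (-1), pt q 0} | q. - int k + 1 \<le> q \<and> q \<le> 0} \<union>
         {{pt (- int k) 0, pt 0 (int k)}})) \<union>
     {{pt q 0, pt (q + 1) 0} | q. 0 \<le> q \<and> q \<le> int k - 1} \<union>
     {{pt (-1) q, pt 0 q} | q. 1 \<le> q \<and> q \<le> int k - 1} \<union>
     {{pt (int k) 0, pt 0 (int k)}}"
proof -
  have *: "of_int q * \<i> = pt 0 q" "(of_int q + 1) * \<i> = pt 0 (q + 1)" "of_int q - \<i> = pt q (-1)"
    "of_int q = pt q 0" "- of_nat k = pt (- int k) 0" "of_nat k * \<i> = pt 0 (int k)"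
    "of_int q + 1 = pt (q + 1) 0" "-1 + of_int q * \<i> = pt (-1) q" "of_nat k = pt (int k) 0" for q
    by (simp_all add: pt_def complex_eq_iff)
  show ?thesis
    \<comment> \<open>The order matters: larger patterns are rewritten first, since
      \<open>of_int q\<close> and \<open>of_nat k\<close> occur inside them.\<close>
    unfolding tree1_edges_def
    unfolding *(8) *(5) *(6) *(3) *(2)
    unfolding *(7) *(1) *(9)
    unfolding *(4) by (rule refl)
qed

section \<open>Parents, depths and paths in the first tree\<close>

text \<open>On the lower half of column 0 and on the columns x < 0 the path to the root runs away
  from the real axis, until a wrap-around edge leads to a column x \<ge> 1. The value at the origin
  is a default, as the root has no parent.\<close>

definition par :: "nat \<Rightarrow> int \<Rightarrow> int \<Rightarrow> complex" where
  "par k x y =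
     (if x \<ge> 1 then (if y = 0 then pt (x - 1) 0 else if y > 0 then pt x (y - 1) else pt x (y + 1))
      else if y < 0 then (if y = - (x + int k) then pt (x + int k) (- x) else pt x (y - 1))
      else if x < 0 then (if y = x + int k then pt (x + int k + 1) (x + 1) else pt x (y + 1))
      else if y = int k then pt (int k) 0 else pt (-1) y)"

text \<open>On \<open>V k\<close> this is the distance from 0 in the first tree. The constant 2k + 1
  appears because the outer end of a left half-column has distance k + 1 and the distances grow from
  there towards the real axis.\<close>

definition depth :: "nat \<Rightarrow> int \<Rightarrow> int \<Rightarrow> int" where
  "depth k x y =
     (if x \<ge> 1 then x + \<bar>y\<bar>
      else if y < 0 then 2 * int k + 1 + x + y
      else if x < 0 then 2 * int k + 1 + x - y
      else if y > 0 then 2 * int k + 1 - y else 0)"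

text \<open>An over-approximation of the path from \<open>0\<close> to \<open>x + yi\<close>: the condition
  \<open>\<bar>a\<bar> + \<bar>b\<bar> \<le> k\<close> is not imposed on its nodes \<open>a + bi\<close>.\<close>

definition on_path :: "nat \<Rightarrow> int \<Rightarrow> int \<Rightarrow> int \<Rightarrow> int \<Rightarrow> bool" where
  "on_path k x y a b \<longleftrightarrow>
     (a = x \<and> b = y) \<or> (a = 0 \<and> b = 0) \<or>
     (if x \<ge> 1 then
        (b = 0 \<and> 0 \<le> a \<and> a \<le> x) \<or> (a = x \<and> (0 \<le> b \<and> b \<le> y \<or> y \<le> b \<and> b \<le> 0))
      else if y < 0 then
        (b = 0 \<and> 0 \<le> a \<and> a \<le> x + int k) \<or> (a = x + int k \<and> 0 \<le> b \<and> b \<le> - x) \<or> (a = x \<and> b \<le> y)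
      else if x < 0 then
        (b = 0 \<and> 0 \<le> a \<and> a \<le> x + int k + 1) \<or> (a = x + int k + 1 \<and> x + 1 \<le> b \<and> b \<le> 0) \<or>
        (a = x \<and> y \<le> b)
      else if y > 0 then
        (b = 0 \<and> 0 \<le> a \<and> a \<le> int k) \<or> (a = -1 \<and> y \<le> b)
      else False)"

text \<open>The strict inequalities in \<open>left_down\<close>, \<open>left_up\<close> and
  \<open>leaf\<close> come from membership in \<open>V k\<close> and say that the end of the column
  is not yet reached.\<close>

lemma par_cases:
  assumes "\<bar>x\<bar> + \<bar>y\<bar> \<le> int k" "(x, y) \<noteq> (0, 0)"
  obtains
    (axis) "x \<ge> 1" "y = 0" "par k x y = pt (x - 1) 0"
  | (right_up) "x \<ge> 1" "y > 0" "par k x y = pt x (y - 1)"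
  | (right_down) "x \<ge> 1" "y < 0" "par k x y = pt x (y + 1)"
  | (bottom) "x \<le> 0" "y < 0" "y = - x - int k" "par k x y = pt (x + int k) (- x)"
  | (left_down) "x \<le> 0" "y < 0" "y > - x - int k" "par k x y = pt x (y - 1)"
  | (top) "x < 0" "y \<ge> 0" "y = x + int k" "par k x y = pt (x + int k + 1) (x + 1)"
  | (left_up) "x < 0" "y \<ge> 0" "y < x + int k" "par k x y = pt x (y + 1)"
  | (apex) "x = 0" "y = int k" "y > 0" "par k x y = pt (int k) 0"
  | (leaf) "x = 0" "0 < y" "y < int k" "par k x y = pt (-1) y"
proof -
  consider "x \<ge> 1" "y = 0" | "x \<ge> 1" "y > 0" | "x \<ge> 1" "y < 0"
    | "x \<le> 0" "y < 0" | "x < 0" "y \<ge> 0" | "x = 0" "y > 0"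
    using assms(2) by fastforce
  then show thesis
  proof cases
    case 1
    then show ?thesis by (intro axis) (simp_all add: par_def)
  next
    case 2
    then show ?thesis by (intro right_up) (simp_all add: par_def)
  next
    case 3
    then show ?thesis by (intro right_down) (simp_all add: par_def)
  next
    case 4
    then show ?thesis
      using assms(1) bottom left_down by (cases "y = - x - int k") (simp_all add: par_def)
  next
    case 5
    then show ?thesis
      using assms(1) top left_up by (cases "y = x + int k") (simp_all add: par_def)
  next
    case 6
    then show ?thesis
      using assms(1) apex leaf by (cases "y = int k") (simp_all add: par_def)
  qed
qed

text \<open>Supplies the closure condition of \<open>rooted_by_path_subset\<close>: passing from a
  parent to its child only lengthens a segment of the described region or adds a new one.\<close>

lemma on_path_par:
  assumes "\<bar>x\<bar> + \<bar>y\<bar> \<le> int k" "(x, y) \<noteq> (0, 0)" "par k x y = pt u v" "on_path k u v a b"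
  shows "on_path k x y a b"
  using assms(1,2)
proof (cases rule: par_cases)
  case axis
  then have "u = x - 1" "v = 0" using assms(3) by auto
  then show ?thesis using axis assms(4) by (cases "x = 1") (auto simp: on_path_def)
next
  case right_up
  then have "u = x" "v = y - 1" using assms(3) by auto
  then show ?thesis using right_up assms(4) by (auto simp: on_path_def)
next
  case right_down
  then have "u = x" "v = y + 1" using assms(3) by auto
  then show ?thesis using right_down assms(4) by (auto simp: on_path_def)
next
  case bottom
  \<comment> \<open>The parent of a column end lies strictly right of the imaginary axis, so its
    path is an axis segment followed by a column segment.\<close>
  then have "u = x + int k" "v = - x" "u \<ge> 1" using assms(1,3) by auto
  with assms(4) have "(a = u \<and> b = - x) \<or> (a = 0 \<and> b = 0) \<or> (b = 0 \<and> 0 \<le> a \<and> a \<le> u) \<or>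
      (a = u \<and> 0 \<le> b \<and> b \<le> - x) \<or> (a = u \<and> - x \<le> b \<and> b \<le> 0)"
    by (simp add: on_path_def; blast)
  then show ?thesis using bottom(1,2) \<open>u = x + int k\<close>
    by (elim disjE conjE; simp add: on_path_def)
next
  case left_down
  then have "u = x" "v = y - 1" using assms(3) by auto
  then show ?thesis using left_down assms(4) by (auto simp: on_path_def)
next
  case top
  then have "u = x + int k + 1" "v = x + 1" "u \<ge> 1" using assms(1,3) by auto
  with assms(4) have "(a = u \<and> b = x + 1) \<or> (a = 0 \<and> b = 0) \<or> (b = 0 \<and> 0 \<le> a \<and> a \<le> u) \<or>
      (a = u \<and> 0 \<le> b \<and> b \<le> x + 1) \<or> (a = u \<and> x + 1 \<le> b \<and> b \<le> 0)"
    by (simp add: on_path_def; blast)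
  then show ?thesis using top(1,2) \<open>u = x + int k + 1\<close>
    by (elim disjE conjE; simp add: on_path_def)
next
  case left_up
  then have "u = x" "v = y + 1" using assms(3) by auto
  then show ?thesis using left_up assms(4) by (auto simp: on_path_def)
next
  case apex
  then have "u = int k" "v = 0" using assms(3) by auto
  then show ?thesis using apex assms(4) by (auto simp: on_path_def)
next
  case leaf
  then have "u = -1" "v = y" using assms(3) by auto
  then show ?thesis using leaf assms(4) by (auto simp: on_path_def)
qed

lemma depth_par:
  assumes "\<bar>x\<bar> + \<bar>y\<bar> \<le> int k" "(x, y) \<noteq> (0, 0)" "par k x y = pt u v"
  shows "\<bar>u\<bar> + \<bar>v\<bar> \<le> int k \<and> 0 \<le> depth k u v \<and> depth k u v < depth k x y"
  using assms(1,2)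
  by (cases rule: par_cases) (use assms(1,3) in \<open>auto simp: depth_def\<close>)

section \<open>Disjointness of the described paths\<close>

text \<open>The rotated tree is tested by turning nodes back, (x, y) to (y, -x). The signs of x and
  y settle every conditional; for x, y \<ge> 1 the two paths are complementary sides of the
  rectangle with corners 0 and x + yi. The bound on a and b trims the over-approximation.\<close>

lemma on_path_disjoint_quarter_turn:
  assumes "\<bar>x\<bar> + \<bar>y\<bar> \<le> int k" "\<bar>a\<bar> + \<bar>b\<bar> \<le> int k" "on_path k x y a b" "on_path k y (- x) b (- a)"
  shows "(a = 0 \<and> b = 0) \<or> (a = x \<and> b = y)"
proof -
  note * = assms[unfolded on_path_def]
  consider "x \<ge> 1" "y \<ge> 1" | "x \<ge> 1" "y = 0" | "x \<ge> 1" "y \<le> -1"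
    | "x = 0" "y \<ge> 1" | "x = 0" "y = 0" | "x = 0" "y \<le> -1"
    | "x \<le> -1" "y \<ge> 1" | "x \<le> -1" "y = 0" | "x \<le> -1" "y \<le> -1"
    by linarith
  then show ?thesis
    by cases (use * in \<open>auto\<close>)
qed

text \<open>For x, y \<ge> 1 the first path reaches x + yi along its column from the real axis; the
  other starts on the negative real axis and enters the same column from its top.\<close>

lemma on_path_disjoint_half_turn:
  assumes "\<bar>x\<bar> + \<bar>y\<bar> \<le> int k" "\<bar>a\<bar> + \<bar>b\<bar> \<le> int k" "on_path k x y a b" "on_path k (- x) (- y) (- a) (- b)"
  shows "(a = 0 \<and> b = 0) \<or> (a = x \<and> b = y)"
proof -
  note * = assms[unfolded on_path_def]
  consider "x \<ge> 1" "y \<ge> 1" | "x \<ge> 1" "y = 0" | "x \<ge> 1" "y \<le> -1"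
    | "x = 0" "y \<ge> 1" | "x = 0" "y = 0" | "x = 0" "y \<le> -1"
    | "x \<le> -1" "y \<ge> 1" | "x \<le> -1" "y = 0" | "x \<le> -1" "y \<le> -1"
    by linarith
  then show ?thesis
    by cases (use * in \<open>auto\<close>)
qed

section \<open>The defining edge set as the set of parent edges\<close>

lemma tree1_edges_par:
  assumes "k \<ge> 2"
  shows "tree1_edges k = {{pt x y, par k x y} | x y. \<bar>x\<bar> + \<bar>y\<bar> \<le> int k \<and> (x, y) \<noteq> (0, 0)}"
proof -
  define E where "E = {{pt x y, par k x y} | x y. \<bar>x\<bar> + \<bar>y\<bar> \<le> int k \<and> (x, y) \<noteq> (0, 0)}"
  have EI: "{pt x y, par k x y} \<in> E" if "\<bar>x\<bar> + \<bar>y\<bar> \<le> int k" "(x, y) \<noteq> (0, 0)" for x y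
    using that unfolding E_def by blast
  have "tree1_edges k = E"
  proof (intro equalityI subsetI)
    fix e assume "e \<in> tree1_edges k"
    let ?A = "{{pt 0 q, pt 0 (q + 1)} | q. 0 \<le> q \<and> q \<le> int k - 1}"
    let ?B = "{{pt q (-1), pt q 0} | q. - int k + 1 \<le> q \<and> q \<le> 0}"
    from \<open>e \<in> tree1_edges k\<close> consider
      (vertical) "e \<in> vertical_edges k" "e \<notin> ?A" "e \<notin> ?B" "e \<noteq> {pt (- int k) 0, pt 0 (int k)}"
      | (axis) q where "e = {pt q 0, pt (q + 1) 0}" "0 \<le> q" "q \<le> int k - 1"
      | (leaf) q where "e = {pt (-1) q, pt 0 q}" "1 \<le> q" "q \<le> int k - 1"
      | (top) "e = {pt (int k) 0, pt 0 (int k)}"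
      unfolding tree1_edges_pt by blast
    then show "e \<in> E"
    proof cases
      case vertical
      obtain x y where e: "e = {pt x y, up k x y}" and xy: "\<bar>x\<bar> + \<bar>y\<bar> \<le> int k"
        using vertical(1) unfolding vertical_edges_eq by blast
      have "\<not> (x = 0 \<and> 0 \<le> y \<and> y < int k)"
      proof
        assume "x = 0 \<and> 0 \<le> y \<and> y < int k"
        then have "e = {pt 0 y, pt 0 (y + 1)} \<and> 0 \<le> y \<and> y \<le> int k - 1"
          unfolding e by (simp add: up_def)
        then have "e \<in> ?A" by (intro CollectI exI)
        then show False using vertical(2) by contradiction
      qed
      moreover have "\<not> (- int k < x \<and> x \<le> 0 \<and> y = -1)"
      proof
        assume "- int k < x \<and> x \<le> 0 \<and> y = -1"
        then have "e = {pt x (-1), pt x 0} \<and> - int k + 1 \<le> x \<and> x \<le> 0"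
          unfolding e by (simp add: up_def)
        then have "e \<in> ?B" by (intro CollectI exI)
        then show False using vertical(3) by contradiction
      qed
      moreover have "\<not> (x = 0 \<and> y = int k)"
        using vertical(4) unfolding e by (auto simp: up_def insert_commute)
      \<comment> \<open>\<open>vertical\<close> is rebound: its first three facts now exclude the
        removed edges in terms of the starting point (x, y).\<close>
      moreover note vertical = calculation e xy
      \<comment> \<open>In the first, second and fourth case the child is \<open>up k x y\<close>,
        in the others it is \<open>pt x y\<close>.\<close>
      consider "x \<ge> 1" "y \<ge> 0" "x + y < int k" | "x \<ge> 1" "y = int k - x" | "x \<ge> 1" "y < 0"
        | "x \<le> 0" "y < -1" | "x < 0" "y \<ge> 0" "y < x + int k" | "x < 0" "y \<ge> 0" "y = x + int k"
        using vertical(1-3) xy by (cases "x \<ge> 1"; cases "y \<ge> 0"; cases "x = 0") force+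
      then show ?thesis
      proof cases
        case 1
        then show ?thesis using vertical EI[of x "y + 1"] by (auto simp: up_def par_def insert_commute)
      next
        case 2
        then have "x \<le> int k" using xy by simp
        then have "up k x y = pt (x - int k) (- x)" "par k (x - int k) (- x) = pt x y"
          using 2 by (auto simp: up_def par_def)
        then show ?thesis
          using e EI[of "x - int k" "- x"] 2 \<open>x \<le> int k\<close> by (simp add: insert_commute)
      next
        case 3
        then show ?thesis using vertical EI[of x y] by (auto simp: up_def par_def insert_commute)
      next
        case 4
        then show ?thesis using vertical EI[of x "y + 1"] by (auto simp: up_def par_def insert_commute)
      next
        case 5
        then show ?thesis using vertical EI[of x y] by (auto simp: up_def par_def insert_commute)
      next
        case 6
        then show ?thesis using vertical EI[of x y] by (auto simp: up_def par_def insert_commute)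
      qed
    next
      case axis
      then show ?thesis using EI[of "q + 1" 0] by (auto simp: par_def insert_commute)
    next
      case leaf
      then show ?thesis using EI[of 0 q] by (auto simp: par_def insert_commute)
    next
      case top
      then show ?thesis using assms EI[of 0 "int k"] by (auto simp: par_def insert_commute)
    qed
  next
    fix e assume "e \<in> E"
    then obtain x y where e: "e = {pt x y, par k x y}" and xy: "\<bar>x\<bar> + \<bar>y\<bar> \<le> int k" "(x, y) \<noteq> (0, 0)"
      unfolding E_def by blast
    \<comment> \<open>Criterion for the vertical edge starting at (a, b) to survive. Edges are
      unordered, so \<open>A\<close>, \<open>B\<close> and \<open>C\<close> must also exclude a
      match with the ends exchanged.\<close>
    have vertical: "{pt a b, up k a b} \<in> tree1_edges k"
      if "\<bar>a\<bar> + \<bar>b\<bar> \<le> int k" "\<not> (a = 0 \<and> 0 \<le> b)" "\<not> (- int k \<le> a \<and> a \<le> 0 \<and> b = -1)" for a b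
    proof -
      have A: "{pt a b, up k a b} \<noteq> {pt 0 q, pt 0 (q + 1)}" if "0 \<le> q" for q
        using \<open>\<not> (a = 0 \<and> 0 \<le> b)\<close> that by (auto simp: up_def doubleton_eq_iff split: if_splits)
      have B: "{pt a b, up k a b} \<noteq> {pt q (-1), pt q 0}" if "- int k + 1 \<le> q" "q \<le> 0" for q
        using \<open>\<not> (- int k \<le> a \<and> a \<le> 0 \<and> b = -1)\<close> \<open>\<bar>a\<bar> + \<bar>b\<bar> \<le> int k\<close> that
        by (auto simp: up_def doubleton_eq_iff split: if_splits)
      have C: "{pt a b, up k a b} \<noteq> {pt (- int k) 0, pt 0 (int k)}"
        using that assms by (auto simp: up_def doubleton_eq_iff split: if_splits)
      have "{pt a b, up k a b} \<in> vertical_edges k"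
        using that(1) unfolding vertical_edges_eq by blast
      then show ?thesis
        unfolding tree1_edges_pt
        by (intro UnI1 DiffI notI, assumption, elim UnE CollectE exE conjE singletonE)
          (use A B C in metis)+
    qed
    have axis_edge: "{pt q 0, pt (q + 1) 0} \<in> tree1_edges k" if "0 \<le> q" "q \<le> int k - 1" for q
      using that unfolding tree1_edges_pt by blast
    have leaf_edge: "{pt (-1) q, pt 0 q} \<in> tree1_edges k" if "1 \<le> q" "q \<le> int k - 1" for q
      using that unfolding tree1_edges_pt by blast
    have top_edge: "{pt (int k) 0, pt 0 (int k)} \<in> tree1_edges k"
      unfolding tree1_edges_pt by blast
    from xy show "e \<in> tree1_edges k"
    proof (cases rule: par_cases)
      case axis
      then show ?thesis using xy axis_edge[of "x - 1"] by (auto simp: e insert_commute)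
    next
      case right_up
      then show ?thesis using xy vertical[of x "y - 1"] by (auto simp: e up_def insert_commute)
    next
      case right_down
      then show ?thesis using xy vertical[of x y] by (auto simp: e up_def insert_commute)
    next
      case bottom
      then show ?thesis using xy vertical[of "x + int k" "- x"] by (auto simp: e up_def insert_commute)
    next
      case left_down
      then show ?thesis using xy vertical[of x "y - 1"] by (auto simp: e up_def insert_commute)
    next
      case top
      then show ?thesis using xy vertical[of x y] by (auto simp: e up_def insert_commute)
    next
      case left_up
      then show ?thesis using xy vertical[of x y] by (auto simp: e up_def insert_commute)
    next
      case apex
      then show ?thesis using xy top_edge assms by (auto simp: e insert_commute)
    next
      case leaf
      then show ?thesis using xy leaf_edge[of y] by (auto simp: e insert_commute)
    qed
  qed
  then show ?thesis unfolding E_def .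
qed

text \<open>Floors recover the integer coordinates, giving functions on complex nodes as
  \<open>rooted_by\<close> requires.\<close>

definition tree_par :: "nat \<Rightarrow> complex \<Rightarrow> complex" where
  "tree_par k z = par k \<lfloor>Re z\<rfloor> \<lfloor>Im z\<rfloor>"

definition tree_depth :: "nat \<Rightarrow> complex \<Rightarrow> nat" where
  "tree_depth k z = nat (depth k \<lfloor>Re z\<rfloor> \<lfloor>Im z\<rfloor>)"

definition tree_path :: "nat \<Rightarrow> complex \<Rightarrow> complex set" where
  "tree_path k z = {pt a b | a b. on_path k \<lfloor>Re z\<rfloor> \<lfloor>Im z\<rfloor> a b}"

lemma tree_par_pt [simp]: "tree_par k (pt x y) = par k x y"
  by (simp add: tree_par_def pt_def)

lemma tree_depth_pt [simp]: "tree_depth k (pt x y) = nat (depth k x y)"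
  by (simp add: tree_depth_def pt_def)

lemma pt_in_tree_path_iff [simp]: "pt a b \<in> tree_path k (pt x y) \<longleftrightarrow> on_path k x y a b"
  by (simp add: tree_path_def) (simp add: pt_def)

lemma par_eq_pt: obtains u v where "par k x y = pt u v"
proof
  show "par k x y = pt \<lfloor>Re (par k x y)\<rfloor> \<lfloor>Im (par k x y)\<rfloor>"
    by (simp add: par_def pt_def)
qed

lemma rooted_by_tree1:
  assumes "k \<ge> 2"
  shows "rooted_by (tree1 k) 0 (tree_par k) (tree_depth k)"
  unfolding rooted_by_def
proof (intro conjI ballI)
  show "0 \<in> nodes (tree1 k)" by (simp add: tree1_def pt_0_0)
  show "edges (tree1 k) = {{v, tree_par k v} | v. v \<in> nodes (tree1 k) - {0}}"
    unfolding tree1_def pt_0_0 by (simp add: tree1_edges_par[OF assms]) (force simp: V_eq)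
next
  fix v assume "v \<in> nodes (tree1 k) - {0}"
  then obtain x y where v: "v = pt x y" "\<bar>x\<bar> + \<bar>y\<bar> \<le> int k" "(x, y) \<noteq> (0, 0)"
    by (auto simp: tree1_def V_eq pt_0_0)
  obtain u w where uw: "par k x y = pt u w" by (rule par_eq_pt)
  note * = depth_par[OF v(2,3) uw]
  show "tree_par k v \<in> nodes (tree1 k)" using * by (simp add: v uw tree1_def)
  show "tree_depth k (tree_par k v) < tree_depth k v" using * by (simp add: v uw)
qed

lemma tree_path_step:
  assumes "v \<in> V k" "v \<noteq> 0"
  shows "insert v (tree_path k (tree_par k v)) \<subseteq> tree_path k v"
proof -
  obtain x y where v: "v = pt x y" "\<bar>x\<bar> + \<bar>y\<bar> \<le> int k" "(x, y) \<noteq> (0, 0)"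
    using assms by (auto simp: V_eq pt_0_0)
  obtain u w where uw: "par k x y = pt u w" by (rule par_eq_pt)
  have "tree_path k (pt u w) \<subseteq> tree_path k (pt x y)"
    unfolding tree_path_def using on_path_par[OF v(2,3) uw] by (auto simp: pt_def)
  moreover have "pt x y \<in> tree_path k (pt x y)"
    by (simp add: on_path_def)
  ultimately show ?thesis by (simp add: v uw)
qed

section \<open>Rotations\<close>

lemma rot_eq: "rot z = \<i> * z"
  by (simp add: rot_def complex_eq_iff)

definition unrot :: "complex \<Rightarrow> complex" where
  "unrot z = - \<i> * z"

lemma unrot_rot [simp]: "unrot (rot z) = z" and rot_unrot [simp]: "rot (unrot z) = z"
  by (simp_all add: unrot_def rot_eq mult.assoc[symmetric])

lemma unrot_pow_rot_pow [simp]: "(unrot ^^ n) ((rot ^^ n) z) = z"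
  by (induction n arbitrary: z) (simp_all add: funpow_swap1)

lemma rot_pow_unrot_pow [simp]: "(rot ^^ n) ((unrot ^^ n) z) = z"
  by (induction n arbitrary: z) (simp_all add: funpow_swap1)

lemma unrot_pow_eq_0_iff [simp]: "(unrot ^^ n) z = 0 \<longleftrightarrow> z = 0"
  by (induction n) (simp_all add: unrot_def)

lemma unrot_pow_eq_iff [simp]: "(unrot ^^ n) z = (unrot ^^ n) w \<longleftrightarrow> z = w"
  using rot_pow_unrot_pow by metis

lemma unrot_pt [simp]: "unrot (pt x y) = pt y (- x)" and rot_pt [simp]: "rot (pt x y) = pt (- y) x"
  by (simp_all add: unrot_def rot_def pt_def complex_eq_iff)

lemma unrot_in_V: "z \<in> V k \<Longrightarrow> unrot z \<in> V k" and rot_in_V: "z \<in> V k \<Longrightarrow> rot z \<in> V k"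
  by (auto simp: V_eq)

lemma unrot_pow_in_V: "z \<in> V k \<Longrightarrow> (unrot ^^ n) z \<in> V k"
  by (induction n) (simp_all add: unrot_in_V)

lemma rot_image_V: "rot ` V k = V k"
  using rot_in_V unrot_in_V rot_unrot by (metis image_subsetI subsetI subset_antisym imageI)

lemma nodes_rot_graph_pow: "nodes T = V k \<Longrightarrow> nodes ((rot_graph ^^ n) T) = V k"
  by (induction n) (simp_all add: rot_graph_def rot_image_V)

lemma rooted_by_rot_pow:
  assumes "rooted_by T 0 f d"
  shows "rooted_by ((rot_graph ^^ n) T) 0 ((rot ^^ n) \<circ> f \<circ> (unrot ^^ n)) (d \<circ> (unrot ^^ n))"
proof (induction n)
  case 0
  then show ?case using assms by simp
next
  case (Suc n)
  have "rooted_by (rot_graph ((rot_graph ^^ n) T)) 0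
      (rot \<circ> ((rot ^^ n) \<circ> f \<circ> (unrot ^^ n)) \<circ> unrot) ((d \<circ> (unrot ^^ n)) \<circ> unrot)"
    by (rule rooted_by_rot[OF Suc unrot_rot]) (simp add: rot_eq)
  moreover have "(unrot ^^ n) \<circ> unrot = unrot ^^ Suc n"
    by (simp add: funpow_Suc_right del: funpow.simps)
  ultimately show ?case by (simp add: comp_def funpow_swap1)
qed

section \<open>The rotated trees as subgraphs of the network\<close>

lemma gauss_cong_rot:
  assumes "gauss_cong k a b"
  shows "gauss_cong k (rot a) (rot b)"
proof -
  obtain x y where "a - b = pt x y * alpha k"
    using assms by (auto simp: gauss_cong_def gauss_ints_def of_int_pt)
  then have "rot a - rot b = pt (- y) x * alpha k"
    by (simp add: rot_eq right_diff_distrib[symmetric] rot_pt[unfolded rot_eq, symmetric])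
  then show ?thesis by (auto simp: gauss_cong_def gauss_ints_def of_int_pt)
qed

lemma network_edges_iff:
  "e \<in> edges (dense_gaussian_network k) \<longleftrightarrow>
     (\<exists>a b. e = {a, b} \<and> a \<in> V k \<and> b \<in> V k \<and> (\<exists>d \<in> {1, -1, \<i>, -\<i>}. gauss_cong k (a - b) d))"
  by (simp only: dense_gaussian_network_def ugraph.simps mem_Collect_eq)

lemma network_edges_rot:
  assumes "e \<in> edges (dense_gaussian_network k)"
  shows "rot ` e \<in> edges (dense_gaussian_network k)"
proof -
  obtain a b d where ab: "e = {a, b}" "a \<in> V k" "b \<in> V k" "d \<in> {1, -1, \<i>, -\<i>}" "gauss_cong k (a - b) d"
    using assms unfolding network_edges_iff by (elim exE conjE bexE)
  then have "gauss_cong k (rot a - rot b) (rot d)"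
    using gauss_cong_rot[of k "a - b" d] by (simp add: rot_eq right_diff_distrib)
  \<comment> \<open>Multiplication by i permutes the four unit differences.\<close>
  moreover have "rot d \<in> {1, -1, \<i>, -\<i>}"
    using ab(4) by (auto simp: rot_eq)
  ultimately show ?thesis
    unfolding network_edges_iff using ab(1-3)
    by (intro exI[of _ "rot a"] exI[of _ "rot b"] conjI bexI[of _ "rot d"])
      (simp_all only: rot_in_V image_insert image_empty)
qed

lemma network_edgeI:
  assumes "pt a b \<in> V k" "pt c d \<in> V k" "(x, y) \<in> {(1, 0), (-1, 0), (0, 1), (0, -1)}"
    and "gauss_cong k (pt (a - c) (b - d)) (pt x y)"
  shows "{pt a b, pt c d} \<in> edges (dense_gaussian_network k)"
proof -
  have "pt x y \<in> {1, -1, \<i>, -\<i>}"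
    using assms(3) by (auto simp: pt_def complex_eq_iff)
  moreover have "pt a b - pt c d = pt (a - c) (b - d)"
    by (simp add: pt_def complex_eq_iff)
  ultimately have "\<exists>e \<in> {1, -1, \<i>, -\<i>}. gauss_cong k (pt a b - pt c d) e"
    using assms(4) by (intro bexI[of _ "pt x y"]) simp_all
  then show ?thesis
    unfolding network_edges_iff using assms(1,2) by (intro exI conjI) (rule refl)
qed

lemma tree1_edges_subset:
  "tree1_edges k \<subseteq> edges (dense_gaussian_network k)"
proof
  fix e assume "e \<in> tree1_edges k"
  then consider
    (vertical) x y where "e = {pt x y, up k x y}" "\<bar>x\<bar> + \<bar>y\<bar> \<le> int k"
    | (axis) q where "e = {pt q 0, pt (q + 1) 0}" "0 \<le> q" "q \<le> int k - 1"
    | (leaf) q where "e = {pt (-1) q, pt 0 q}" "1 \<le> q" "q \<le> int k - 1"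
    | (top) "e = {pt (int k) 0, pt 0 (int k)}"
    unfolding tree1_edges_pt vertical_edges_eq by blast
  then show "e \<in> edges (dense_gaussian_network k)"
  proof cases
    case vertical
    obtain a b where ab: "up k x y = pt a b" "\<bar>a\<bar> + \<bar>b\<bar> \<le> int k"
      using up_props[OF vertical(2)] by (auto simp: V_eq)
    have "gauss_cong k (pt a b) (pt x (y + 1))"
      using up_props[OF vertical(2)] ab by simp
    then have "gauss_cong k (pt (a - x) (b - y)) (pt 0 1)"
      by (simp add: gauss_cong_pt algebra_simps)
    then have "{pt a b, pt x y} \<in> edges (dense_gaussian_network k)"
      using ab vertical(2) by (intro network_edgeI[where x = 0 and y = 1]) auto
    then show ?thesis by (simp add: vertical ab insert_commute)
  next
    case axis
    have "gauss_cong k (pt (-1) 0) (pt (-1) 0)"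
      by (auto simp: gauss_cong_pt intro!: exI[of _ "0 :: int", OF exI[of _ "0 :: int"]])
    then show ?thesis
      using axis by (auto intro!: network_edgeI[where x = "-1" and y = 0])
  next
    case leaf
    have "gauss_cong k (pt (-1) 0) (pt (-1) 0)"
      by (auto simp: gauss_cong_pt intro!: exI[of _ "0 :: int", OF exI[of _ "0 :: int"]])
    then show ?thesis
      using leaf by (auto intro!: network_edgeI[where x = "-1" and y = 0])
  next
    case top
    \<comment> \<open>Here k - ki + 1 = -i \<alpha>, so the edge between k and ki is a horizontal
      edge that wraps around.\<close>
    have "gauss_cong k (pt (int k) (- int k)) (pt (-1) 0)"
      by (auto simp: gauss_cong_pt intro!: exI[of _ "0 :: int", OF exI[of _ "-1 :: int"]])
    then show ?thesis
      using top by (auto intro!: network_edgeI[where x = "-1" and y = 0])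
  qed
qed

lemma rot_graph_pow_edges_subset:
  assumes "edges T \<subseteq> edges (dense_gaussian_network k)"
  shows "edges ((rot_graph ^^ n) T) \<subseteq> edges (dense_gaussian_network k)"
  using assms by (induction n) (auto simp: rot_graph_def network_edges_rot)

section \<open>Pairwise independence\<close>

lemma tree_path_rot_disjoint:
  assumes "u \<in> V k" "w \<in> V k" "0 < m" "m < 4"
    and "w \<in> tree_path k u" "(unrot ^^ m) w \<in> tree_path k ((unrot ^^ m) u)"
  shows "w = 0 \<or> w = u"
proof -
  obtain x y a b where uw: "u = pt x y" "\<bar>x\<bar> + \<bar>y\<bar> \<le> int k" "w = pt a b" "\<bar>a\<bar> + \<bar>b\<bar> \<le> int k"
    using assms(1,2) by (auto simp: V_eq)
  consider "m = 1" | "m = 2" | "m = 3" using assms(3,4) by linarith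
  then have "(a = 0 \<and> b = 0) \<or> (a = x \<and> b = y)"
  proof cases
    case 1
    then show ?thesis using on_path_disjoint_quarter_turn[of x y k a b] assms(5,6) uw by simp
  next
    case 2
    then show ?thesis
      using on_path_disjoint_half_turn[of x y k a b] assms(5,6) uw by (simp add: numeral_eq_Suc)
  next
    case 3
    \<comment> \<open>Three inverse quarter turns are one forward turn, to (-y, x). An inverse
      quarter turn of that node gives (x, y) again, so the quarter-turn lemma applies with the two
      trees exchanged.\<close>
    then show ?thesis
      using on_path_disjoint_quarter_turn[of "- y" x k "- b" a] assms(5,6) uw by (auto simp: numeral_eq_Suc)
  qed
  then show ?thesis by (auto simp: uw pt_0_0)
qed

lemma node_independent_sym: "node_independent G r S T \<Longrightarrow> node_independent G r T S"
  unfolding node_independent_def by (metis Int_commute)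

lemma node_independent_rot_pow:
  assumes k: "k \<ge> 2" and ij: "i < j" "j < i + 4"
  shows "node_independent (dense_gaussian_network k) 0 ((rot_graph ^^ i) (tree1 k)) ((rot_graph ^^ j) (tree1 k))"
proof -
  let ?T = "\<lambda>n. (rot_graph ^^ n) (tree1 k)"
  \<comment> \<open>The region enclosing the path to \<open>u\<close> in the \<open>n\<close>-fold
    rotated tree, pulled back to the first tree.\<close>
  let ?S = "\<lambda>n u. {w. (unrot ^^ n) w \<in> tree_path k ((unrot ^^ n) u)}"
  note rooted = rooted_by_rot_pow[OF rooted_by_tree1[OF k]]
  have nodes: "nodes (?T n) = V k" for n
    by (rule nodes_rot_graph_pow) (simp add: tree1_def)
  have spanning: "is_spanning_tree (?T n) (dense_gaussian_network k)" for n
    unfolding is_spanning_tree_def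
  proof (intro conjI)
    show "is_tree (?T n)" by (rule rooted_by_is_tree[OF rooted])
    show "nodes (?T n) = nodes (dense_gaussian_network k)"
      by (simp add: nodes dense_gaussian_network_def)
    show "edges (?T n) \<subseteq> edges (dense_gaussian_network k)"
      by (rule rot_graph_pow_edges_subset) (simp add: tree1_def tree1_edges_subset)
  qed
  have path: "set p \<subseteq> ?S n u" if "is_path (?T n) 0 p u" for n p u
  proof (rule rooted_by_path_subset[OF rooted that])
    have "0 \<in> tree_path k 0"
      unfolding pt_0_0 by (simp add: on_path_def)
    then show "0 \<in> ?S n 0" by (simp add: unrot_pow_eq_0_iff[THEN iffD2])
    fix v assume v: "v \<in> nodes (?T n)" "v \<noteq> 0"
    then have "insert ((unrot ^^ n) v) (tree_path k (tree_par k ((unrot ^^ n) v)))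
        \<subseteq> tree_path k ((unrot ^^ n) v)"
      by (intro tree_path_step) (simp_all add: nodes unrot_pow_in_V)
    then show "insert v (?S n (((rot ^^ n) \<circ> tree_par k \<circ> (unrot ^^ n)) v)) \<subseteq> ?S n v"
      by auto
  qed
  show ?thesis
    unfolding node_independent_def
  proof (intro conjI ballI impI allI)
    show "0 \<in> nodes (dense_gaussian_network k)"
      by (simp add: dense_gaussian_network_def pt_0_0)
    show "is_spanning_tree (?T i) (dense_gaussian_network k)"
      "is_spanning_tree (?T j) (dense_gaussian_network k)"
      by (rule spanning)+
    fix u p q
    assume u: "u \<in> nodes (dense_gaussian_network k)"
      and pq: "is_path (?T i) 0 p u \<and> is_path (?T j) 0 q u"
    have "{0, u} \<subseteq> set p \<inter> set q"
      using pq unfolding is_path_def by (metis IntI empty_subsetI hd_in_set insert_subset last_in_set)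
    moreover have "set p \<inter> set q \<subseteq> {0, u}"
    proof
      fix w assume w: "w \<in> set p \<inter> set q"
      \<comment> \<open>Turning back by \<open>i\<close> quarter turns makes the first of the two
        trees \<open>tree1\<close>; what remains is the relative turn \<open>j - i\<close>, which
        lies between 1 and 3.\<close>
      define u' w' where "u' = (unrot ^^ i) u" and "w' = (unrot ^^ i) w"
      have "w \<in> V k" using w pq nodes[of i] by (auto simp: is_path_def)
      then have V: "u' \<in> V k" "w' \<in> V k"
        using u by (simp_all add: u'_def w'_def unrot_pow_in_V dense_gaussian_network_def)
      have "w' \<in> tree_path k u'"
        using w path[of i p u] pq by (auto simp: u'_def w'_def)
      moreover have "(unrot ^^ j) z = (unrot ^^ (j - i)) ((unrot ^^ i) z)" for z
        using ij(1) funpow_add[of "j - i" i unrot] by simp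
      then have "(unrot ^^ (j - i)) w' \<in> tree_path k ((unrot ^^ (j - i)) u')"
        using w path[of j q u] pq by (auto simp: u'_def w'_def)
      ultimately have "w' = 0 \<or> w' = u'"
        using tree_path_rot_disjoint[OF V, of "j - i"] ij by auto
      then show "w \<in> {0, u}" by (simp add: u'_def w'_def)
    qed
    ultimately show "set p \<inter> set q = {0, u}" by blast
  qed
qed

theorem lemma6:
  fixes k :: nat
  assumes "k \<ge> 2"
  shows "pairwise (\<lambda>i j. node_independent (dense_gaussian_network k) 0
                            (gauss_tree k i) (gauss_tree k j)) {1..4}"
proof (rule pairwiseI)
  fix i j :: nat assume ij: "i \<in> {1..4}" "j \<in> {1..4}" "i \<noteq> j"
  show "node_independent (dense_gaussian_network k) 0 (gauss_tree k i) (gauss_tree k j)"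
  proof (cases "i < j")
    case True
    then have "i - 1 < j - 1" "j - 1 < (i - 1) + 4" using ij by auto
    then show ?thesis unfolding gauss_tree_def by (rule node_independent_rot_pow[OF assms])
  next
    case False
    then have "j - 1 < i - 1" "i - 1 < (j - 1) + 4" using ij by auto
    then show ?thesis
      unfolding gauss_tree_def by (rule node_independent_sym[OF node_independent_rot_pow[OF assms]])
  qed
qed

end
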